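(* Let $\mathcal{H}$ be a complex Hilbert space with scalar product $\langle\cdot,\cdot\rangle$ and norm $\|\cdot\|$. Let $A:\mathcal{D}\subset\mathcal{H}\to\mathcal{H}$ be a self-adjoint operator defined on a dense domain $\mathcal{D}$, semibounded below, with discrete spectrum $\lambda_1\le\lambda_2\le\lambda_3\le\cdots$, where $\lambda_1>0$. Let $n\ge 1$, let $\{T_p:\mathcal{D}\to\mathcal{H}\}_{p=1}^n$ be a collection of skew-symmetric operators, and let $\{B_p\}_{p=1}^n$ be a collection of symmetric operators with values in $\mathcal{H}$, each $B_p$ being defined on $\mathcal{D}$ and on $T_p(\mathcal{D})$ and leaving $\mathcal{D}$ invariant (i.e. $B_p(\mathcal{D})\subset\mathcal{D}$). Let $\{u_i\}_{i=1}^\infty$ be a basis of orthonormal eigenvectors of $A$, with $u_i$ corresponding to $\lambda_i$. Let $k\ge1$ and assume that $\lambda_{k+1}>\lambda_k$. Then, for every couple $(f,g)\in\Im_{\lambda_{k+1}}$, $$\bigg(\sum_{i=1}^k\sum_{p=1}^n f(\lambda_i)\langle[T_p,B_p]u_i,u_i\rangle\bigg)^2\le 4\bigg(\sum_{i=1}^k\sum_{p=1}^n g(\lambda_i)\langle[A,B_p]u_i,B_pu_i\rangle\bigg)\bigg(\sum_{i=1}^k\sum_{p=1}^n\frac{(f(\lambda_i))^2}{g(\lambda_i)(\lambda_{k+1}-\lambda_i)}\|T_pu_i\|^2\bigg).$$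
   Context: For operators $S,T$, the commutator is $[S,T]=ST-TS$. Eigenvalues are listed with multiplicity. Definition of $\Im_\lambda$: for $\lambda>0$, a couple $(f,g)$ of real-valued functions defined on the open interval $]0,\lambda[$ belongs to $\Im_\lambda$ if (1) $f$ and $g$ are positive, and (2) for all $x,y\in]0,\lambda[$ with $x\neq y$, $$\Big(\frac{f(x)-f(y)}{x-y}\Big)^2+\Big(\frac{(f(x))^2}{g(x)(\lambda-x)}+\frac{(f(y))^2}{g(y)(\lambda-y)}\Big)\Big(\frac{g(x)-g(y)}{x-y}\Big)\le0.$$ An operator $B$ is symmetric if $\langle Bv,w\rangle=\langle v,Bw\rangle$, and an operator $T$ is skew-symmetric if $\langle Tv,w\rangle=-\langle v,Tw\rangle$, for all $v,w$ in its domain. *)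

theory Defs
  imports "HOL-Analysis.Analysis" "HOL-Library.Complex_Order"
begin

section \<open>Complex Hilbert spaces\<close>

class complex_vector = real_vector +
  fixes scaleC :: "complex \<Rightarrow> 'a \<Rightarrow> 'a"  (infixr "*\<^sub>C" 75)
  assumes scaleC_add_right: "c *\<^sub>C (x + y) = c *\<^sub>C x + c *\<^sub>C y"
    and scaleC_add_left: "(c + d) *\<^sub>C x = c *\<^sub>C x + d *\<^sub>C x"
    and scaleC_scaleC: "c *\<^sub>C d *\<^sub>C x = (c * d) *\<^sub>C x"
    and scaleC_one: "1 *\<^sub>C x = x"
    and scaleC_of_real: "complex_of_real r *\<^sub>C x = r *\<^sub>R x"

interpretation complex_vector:
  vector_space "scaleC :: complex \<Rightarrow> 'a \<Rightarrow> 'a::complex_vector"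
  by unfold_locales
    (simp_all add: scaleC_add_right scaleC_add_left scaleC_scaleC scaleC_one)

text \<open>The scalar product is linear in its first argument. Positivity is stated in the order
  of \<open>complex\<close>, for which \<open>a \<le> b\<close> means \<open>Re a \<le> Re b \<and> Im a = Im b\<close>.\<close>

class complex_inner = complex_vector + real_normed_vector +
  fixes cinner :: "'a \<Rightarrow> 'a \<Rightarrow> complex"
  assumes cinner_commute: "cinner x y = cnj (cinner y x)"
    and cinner_add_left: "cinner (x + y) z = cinner x z + cinner y z"
    and cinner_scaleC_left: "cinner (c *\<^sub>C x) y = c * cinner x y"
    and cinner_ge_zero: "0 \<le> cinner x x"
    and cinner_eq_zero_iff: "cinner x x = 0 \<longleftrightarrow> x = 0"
    and norm_eq_sqrt_cinner: "norm x = sqrt (Re (cinner x x))"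

class chilbert_space = complex_inner + complete_space


section \<open>Unbounded operators\<close>

text \<open>A possibly unbounded operator is a total function \<open>A\<close> together with its domain \<open>D\<close>;
  the values of \<open>A\<close> outside \<open>D\<close> carry no meaning.\<close>

definition operator_on :: "'a::complex_vector set \<Rightarrow> ('a \<Rightarrow> 'a) \<Rightarrow> bool" where
  "operator_on D A \<longleftrightarrow> complex_vector.subspace D \<and>
     (\<forall>v\<in>D. \<forall>w\<in>D. A (v + w) = A v + A w) \<and> (\<forall>c. \<forall>v\<in>D. A (c *\<^sub>C v) = c *\<^sub>C A v)"

definition symmetric_on :: "'a::complex_inner set \<Rightarrow> ('a \<Rightarrow> 'a) \<Rightarrow> bool" where
  "symmetric_on D A \<longleftrightarrow> (\<forall>v\<in>D. \<forall>w\<in>D. cinner (A v) w = cinner v (A w))"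

definition skew_symmetric_on :: "'a::complex_inner set \<Rightarrow> ('a \<Rightarrow> 'a) \<Rightarrow> bool" where
  "skew_symmetric_on D A \<longleftrightarrow> (\<forall>v\<in>D. \<forall>w\<in>D. cinner (A v) w = - cinner v (A w))"

definition commutator :: "('a \<Rightarrow> 'a) \<Rightarrow> ('a \<Rightarrow> 'a) \<Rightarrow> 'a \<Rightarrow> 'a::ab_group_add" where
  "commutator S T v = S (T v) - T (S v)"

definition operator_graph :: "'a set \<Rightarrow> ('a \<Rightarrow> 'a) \<Rightarrow> ('a \<times> 'a) set" where
  "operator_graph D A = {(v, A v) | v. v \<in> D}"

text \<open>The graph of the adjoint; it is the graph of a function when \<open>D\<close> is dense.\<close>

definition adjoint_graph :: "'a::complex_inner set \<Rightarrow> ('a \<Rightarrow> 'a) \<Rightarrow> ('a \<times> 'a) set" where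
  "adjoint_graph D A = {(w, z). \<forall>v\<in>D. cinner (A v) w = cinner v z}"

definition self_adjoint_on :: "'a::complex_inner set \<Rightarrow> ('a \<Rightarrow> 'a) \<Rightarrow> bool" where
  "self_adjoint_on D A \<longleftrightarrow>
     operator_on D A \<and> closure D = UNIV \<and> adjoint_graph D A = operator_graph D A"

definition semibounded_below_on :: "'a::complex_inner set \<Rightarrow> ('a \<Rightarrow> 'a) \<Rightarrow> bool" where
  "semibounded_below_on D A \<longleftrightarrow> (\<exists>m. \<forall>v\<in>D. m * (norm v)\<^sup>2 \<le> Re (cinner (A v) v))"


section \<open>Discrete spectrum\<close>

definition resolvent_set :: "'a::complex_inner set \<Rightarrow> ('a \<Rightarrow> 'a) \<Rightarrow> complex set" where
  "resolvent_set D A = {z. bij_betw (\<lambda>v. A v - z *\<^sub>C v) D UNIV \<and>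
     bounded_linear (the_inv_into D (\<lambda>v. A v - z *\<^sub>C v))}"

definition spectrum :: "'a::complex_inner set \<Rightarrow> ('a \<Rightarrow> 'a) \<Rightarrow> complex set" where
  "spectrum D A = - resolvent_set D A"

definition eigenspace :: "'a::complex_inner set \<Rightarrow> ('a \<Rightarrow> 'a) \<Rightarrow> complex \<Rightarrow> 'a set" where
  "eigenspace D A z = {v \<in> D. A v = z *\<^sub>C v}"

text \<open>The spectrum consists of isolated eigenvalues of finite multiplicity.\<close>

definition discrete_spectrum :: "'a::complex_inner set \<Rightarrow> ('a \<Rightarrow> 'a) \<Rightarrow> bool" where
  "discrete_spectrum D A \<longleftrightarrow> (\<forall>z \<in> spectrum D A. z isolated_in spectrum D A \<and>
     eigenspace D A z \<noteq> {0} \<and>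
     (\<exists>F. finite F \<and> complex_vector.span F = eigenspace D A z))"

text \<open>\<open>ev 1 \<le> ev 2 \<le> \<dots>\<close> enumerates the spectrum, each point occurring as many times as its
  multiplicity. Indexing starts at 1, so \<open>ev 0\<close> is irrelevant.\<close>

definition eigenvalue_sequence ::
  "'a::complex_inner set \<Rightarrow> ('a \<Rightarrow> 'a) \<Rightarrow> (nat \<Rightarrow> real) \<Rightarrow> bool" where
  "eigenvalue_sequence D A ev \<longleftrightarrow> mono_on {1..} ev \<and>
     spectrum D A = (\<lambda>i. complex_of_real (ev i)) ` {1..} \<and>
     (\<forall>i\<ge>1. card {j. 1 \<le> j \<and> ev j = ev i} =
        complex_vector.dim (eigenspace D A (complex_of_real (ev i))))"

text \<open>An orthonormal family indexed by the positive integers with dense span.\<close>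

definition orthonormal_basis :: "(nat \<Rightarrow> 'a::complex_inner) \<Rightarrow> bool" where
  "orthonormal_basis u \<longleftrightarrow>
     (\<forall>i\<ge>1. \<forall>j\<ge>1. cinner (u i) (u j) = (if i = j then 1 else 0)) \<and>
     closure (complex_vector.span (u ` {1..})) = UNIV"


section \<open>Admissible couples of functions\<close>

text \<open>Couples of functions on the open interval from 0 to \<open>l\<close>, represented by total functions
  whose values outside the interval are irrelevant.\<close>

definition Im_class :: "real \<Rightarrow> ((real \<Rightarrow> real) \<times> (real \<Rightarrow> real)) set" where
  "Im_class l = {(f, g).
     (\<forall>x\<in>{0<..<l}. 0 < f x \<and> 0 < g x) \<and>
     (\<forall>x\<in>{0<..<l}. \<forall>y\<in>{0<..<l}. x \<noteq> y \<longrightarrow>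
        ((f x - f y) / (x - y))\<^sup>2 +
        ((f x)\<^sup>2 / (g x * (l - x)) + (f y)\<^sup>2 / (g y * (l - y))) * ((g x - g y) / (x - y)) \<le> 0)}"

end

theory Submission
  imports Defs
begin

text \<open>Let \<open>P\<close> be the orthogonal projection onto the span of \<open>u 1, \<dots>, u k\<close>. For each
  \<open>p\<close>, splitting \<open>B u\<^sub>i\<close> and \<open>T u\<^sub>i\<close> along \<open>P\<close>
  and bounding \<open>A\<close> below by \<open>\<lambda>\<^bsub>k+1\<^esub>\<close> on the range of \<open>1 - P\<close>
  shows that the quadratic polynomial in a real variable \<open>s\<close>, whose coefficients are the three sums of
  the theorem, dominates a sum of quadratic forms in the residuals plus a double sum over matrix entries. The
  former are nonnegative by Cauchy--Schwarz; the latter, once symmetrised in \<open>i, j\<close>, is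
  nonnegative by the condition defining the class of couples \<open>(f, g)\<close>. After summation over
  \<open>p\<close>, the theorem says that the discriminant of a nonnegative quadratic is nonpositive.\<close>

section \<open>Real quadratic forms\<close>

lemma discriminant_le_zero:
  fixes a b c :: real
  assumes nonneg: "\<And>s. 0 \<le> s\<^sup>2 * a + s * b + c"
  shows "b\<^sup>2 \<le> 4 * a * c"
proof (cases "b = 0")
  case True
  have c: "0 \<le> c" using nonneg[of 0] by simp
  have "0 \<le> a * c"
  proof (rule ccontr)
    assume "\<not> 0 \<le> a * c"
    with c have "c > 0" "a < 0" by (auto simp: not_le mult_less_0_iff)
    \<comment> \<open>With \<open>b = 0\<close>, the polynomial takes the negative value
      \<open>- c\<close> at this point.\<close>
    moreover have "(sqrt (2 * c / - a))\<^sup>2 = 2 * c / - a"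
      using calculation by (intro real_sqrt_pow2 divide_nonneg_pos) auto
    ultimately show False
      using nonneg[of "sqrt (2 * c / - a)"] True by (simp add: field_simps)
  qed
  then show ?thesis using True by simp
next
  case False
  have c: "0 \<le> c" using nonneg[of 0] by simp
  show ?thesis
  proof (cases "c = 0")
    case True
    \<comment> \<open>A short step against the sign of \<open>b\<close>: \<open>t * a < 1\<close>
      holds for either sign of \<open>a\<close>, so the linear term wins at
      \<open>s = - t * b\<close>.\<close>
    define t where "t = 1 / (2 * (\<bar>a\<bar> + 1))"
    have t: "0 < t" "t * a < 1"
      by (auto simp: t_def field_simps abs_if)
    have "(t * b\<^sup>2) * (t * a - 1) < 0"
      using t False by (intro mult_pos_neg) auto
    moreover have "0 \<le> (t * b\<^sup>2) * (t * a - 1)"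
      using nonneg[of "- t * b"] True by (simp add: algebra_simps power2_eq_square)
    ultimately show ?thesis by simp
  next
    case False
    with c have c: "0 < c" by simp
    \<comment> \<open>Division by \<open>s\<^sup>2\<close> leaves a quadratic in
      \<open>1 / s\<close> with leading coefficient \<open>c > 0\<close>; its vertex
      \<open>1 / s = - b / (2 * c)\<close> gives this point.\<close>
    have "0 \<le> (- 2 * c / b)\<^sup>2 * a + (- 2 * c / b) * b + c" by (rule nonneg)
    also have "\<dots> = (c / b\<^sup>2) * (4 * a * c - b\<^sup>2)"
      using \<open>b \<noteq> 0\<close> by (simp add: field_simps power2_eq_square)
    finally have "0 \<le> (c / b\<^sup>2) * (4 * a * c - b\<^sup>2)" .
    moreover have "0 < c / b\<^sup>2" using c \<open>b \<noteq> 0\<close> by simp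
    ultimately show ?thesis by (simp only: zero_le_mult_iff) linarith
  qed
qed

text \<open>Arithmetic-geometric mean inequality: the middle term is at most twice the geometric
  mean of the outer ones. In use, \<open>x\<close> and \<open>y\<close> measure components of the
  images under \<open>B\<close> and \<open>T\<close>, and \<open>r\<close> is the real part of their
  product.\<close>

lemma quadratic_form_nonneg:
  fixes a b c s x y r :: real
  assumes "0 \<le> a" "0 \<le> c" "b\<^sup>2 \<le> a * c" "\<bar>r\<bar> \<le> x * y"
  shows "0 \<le> s\<^sup>2 * (a * x\<^sup>2) + s * (- 2 * b * r) + c * y\<^sup>2"
proof -
  have "r\<^sup>2 \<le> (x * y)\<^sup>2"
    using assms(4) by (metis abs_ge_zero order.trans abs_le_square_iff abs_of_nonneg)
  then have "(b\<^sup>2 * r\<^sup>2) \<le> (a * c) * (x * y)\<^sup>2"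
    using assms by (intro mult_mono) auto
  then have "(s * (- 2 * b * r))\<^sup>2 \<le> 4 * (s\<^sup>2 * (a * x\<^sup>2)) * (c * y\<^sup>2)"
    using mult_left_mono[of "b\<^sup>2 * r\<^sup>2" "(a * c) * (x * y)\<^sup>2" "4 * s\<^sup>2"]
    by (simp add: power2_eq_square mult.assoc mult.left_commute)
  also have "\<dots> \<le> (s\<^sup>2 * (a * x\<^sup>2) + c * y\<^sup>2)\<^sup>2"
    using sum_squares_ge_zero[of "s\<^sup>2 * (a * x\<^sup>2) - c * y\<^sup>2" 0]
    by (simp add: power2_eq_square algebra_simps)
  finally have "\<bar>s * (- 2 * b * r)\<bar> \<le> \<bar>s\<^sup>2 * (a * x\<^sup>2) + c * y\<^sup>2\<bar>"
    by (simp only: abs_le_square_iff)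
  moreover have "0 \<le> s\<^sup>2 * (a * x\<^sup>2) + c * y\<^sup>2"
    using assms by simp
  ultimately show ?thesis by linarith
qed

lemma double_sum_nonneg_symmetrized:
  fixes q :: "'i \<Rightarrow> 'i \<Rightarrow> real"
  assumes "\<And>i j. i \<in> I \<Longrightarrow> j \<in> I \<Longrightarrow> 0 \<le> q i j + q j i"
  shows "0 \<le> (\<Sum>i\<in>I. \<Sum>j\<in>I. q i j)"
proof -
  have "2 * (\<Sum>i\<in>I. \<Sum>j\<in>I. q i j) = (\<Sum>i\<in>I. \<Sum>j\<in>I. q i j) + (\<Sum>i\<in>I. \<Sum>j\<in>I. q j i)"
    using sum.swap[of q I I] by simp
  also have "\<dots> = (\<Sum>i\<in>I. \<Sum>j\<in>I. q i j + q j i)"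
    by (simp add: sum.distrib)
  also have "0 \<le> \<dots>"
    using assms by (intro sum_nonneg) auto
  finally show ?thesis by simp
qed

section \<open>Orthogonal projection onto finitely many vectors\<close>

lemma cinner_add_right: "cinner x (y + z) = cinner x y + cinner x z"
  by (metis cinner_add_left cinner_commute complex_cnj_add)

lemma cinner_scaleC_right: "cinner x (c *\<^sub>C y) = cnj c * cinner x y"
  by (metis cinner_commute cinner_scaleC_left complex_cnj_mult)

lemma cinner_zero_left [simp]: "cinner 0 x = 0"
  using cinner_add_left[of 0 0 x] by simp

lemma cinner_zero_right [simp]: "cinner x 0 = 0"
  using cinner_add_right[of x 0 0] by simp

lemma cinner_diff_left: "cinner (x - y) z = cinner x z - cinner y z"
  using cinner_add_left[of "x - y" y z] by simp

lemma cinner_diff_right: "cinner x (y - z) = cinner x y - cinner x z"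
  using cinner_add_right[of x "y - z" z] by simp

lemma cinner_sum_left: "cinner (\<Sum>i\<in>I. x i) y = (\<Sum>i\<in>I. cinner (x i) y)"
  by (induction I rule: infinite_finite_induct) (auto simp: cinner_add_left)

lemma cinner_sum_right: "cinner x (\<Sum>i\<in>I. y i) = (\<Sum>i\<in>I. cinner x (y i))"
  by (induction I rule: infinite_finite_induct) (auto simp: cinner_add_right)

lemma cinner_self: "cinner x x = complex_of_real ((norm x)\<^sup>2)"
  using cinner_ge_zero[of x]
  by (simp add: norm_eq_sqrt_cinner less_eq_complex_def complex_eq_iff)

text \<open>Cauchy-Schwarz, read off from the discriminant of the squared norm of
  \<open>s x + y\<close>. A real variable \<open>s\<close> yields the real part, which is the
  quantity estimated later.\<close>

lemma abs_Re_cinner_le: "\<bar>Re (cinner x y)\<bar> \<le> norm x * norm y"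
proof -
  have "0 \<le> s\<^sup>2 * (norm x)\<^sup>2 + s * (2 * Re (cinner x y)) + (norm y)\<^sup>2" for s
  proof -
    have "Re (cinner y x) = Re (cinner x y)"
      by (subst cinner_commute) simp
    then have "Re (cinner (complex_of_real s *\<^sub>C x + y) (complex_of_real s *\<^sub>C x + y)) =
        s\<^sup>2 * (norm x)\<^sup>2 + s * (2 * Re (cinner x y)) + (norm y)\<^sup>2"
      unfolding cinner_add_left cinner_add_right cinner_scaleC_left cinner_scaleC_right
      by (simp add: cinner_self algebra_simps power2_eq_square)
    then have "(norm (complex_of_real s *\<^sub>C x + y))\<^sup>2 =
        s\<^sup>2 * (norm x)\<^sup>2 + s * (2 * Re (cinner x y)) + (norm y)\<^sup>2"
      by (simp add: cinner_self)
    then show ?thesis by (metis zero_le_power2)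
  qed
  from discriminant_le_zero[OF this] have "(Re (cinner x y))\<^sup>2 \<le> (norm x * norm y)\<^sup>2"
    by (simp add: power_mult_distrib)
  then show ?thesis
    by (simp add: abs_le_square_iff[symmetric])
qed

section \<open>Residuals and the Pythagorean identity\<close>

definition orthonormal_on :: "'i set \<Rightarrow> ('i \<Rightarrow> 'a::complex_inner) \<Rightarrow> bool" where
  "orthonormal_on I u \<longleftrightarrow> (\<forall>i\<in>I. \<forall>j\<in>I. cinner (u i) (u j) = (if i = j then 1 else 0))"

text \<open>For finite \<open>I\<close> and orthonormal \<open>u\<close> this is
  \<open>(1 - P) v\<close>, with \<open>P\<close> the orthogonal projection onto the span of the
  \<open>u j\<close>. For infinite \<open>I\<close> the sum defaults to 0 and the residual is
  \<open>v\<close>.\<close>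

definition residual :: "'i set \<Rightarrow> ('i \<Rightarrow> 'a::complex_inner) \<Rightarrow> 'a \<Rightarrow> 'a" where
  "residual I u v = v - (\<Sum>j\<in>I. cinner v (u j) *\<^sub>C u j)"

lemma residual_add: "residual I u (v + w) = residual I u v + residual I u w"
  by (simp add: residual_def cinner_add_left scaleC_add_left sum.distrib)

lemma residual_diff: "residual I u (v - w) = residual I u v - residual I u w"
  using residual_add[of I u "v - w" w] by (simp add: algebra_simps)

lemma residual_scaleC: "residual I u (c *\<^sub>C v) = c *\<^sub>C residual I u v"
  by (simp add: residual_def cinner_scaleC_left complex_vector.scale_right_diff_distrib
    complex_vector.scale_sum_right)

lemma cinner_residual_left:
  assumes "finite I" "orthonormal_on I u" "i \<in> I"
  shows "cinner (residual I u v) (u i) = 0"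
proof -
  have "cinner (\<Sum>j\<in>I. cinner v (u j) *\<^sub>C u j) (u i) =
      (\<Sum>j\<in>I. if j = i then cinner v (u j) else 0)"
    unfolding cinner_sum_left using assms
    by (intro sum.cong) (auto simp: cinner_scaleC_left orthonormal_on_def)
  then show ?thesis
    using assms by (simp add: residual_def cinner_diff_left)
qed

text \<open>Pythagoras in polarised form: a residual is orthogonal to every \<open>u j\<close>, so
  the cross terms vanish. The two-vector version is needed for products of a \<open>T\<close> image
  with a \<open>B\<close> image.\<close>

lemma cinner_residual_split:
  assumes "finite I" "orthonormal_on I u"
  shows "cinner v w = cinner (residual I u v) (residual I u w) +
    (\<Sum>j\<in>I. cinner v (u j) * cnj (cinner w (u j)))"
proof -
  have "cinner (residual I u v) (residual I u w) = cinner (residual I u v) w"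
    by (subst (2) residual_def)
      (simp add: cinner_diff_right cinner_sum_right cinner_scaleC_right cinner_residual_left[OF assms])
  also have "\<dots> = cinner v w - (\<Sum>j\<in>I. cinner v (u j) * cinner (u j) w)"
    by (simp add: residual_def cinner_diff_left cinner_sum_left cinner_scaleC_left)
  also have "(\<Sum>j\<in>I. cinner v (u j) * cinner (u j) w) = (\<Sum>j\<in>I. cinner v (u j) * cnj (cinner w (u j)))"
    using cinner_commute[of _ w] by (intro sum.cong) auto
  finally show ?thesis by simp
qed

lemma norm_residual_split:
  assumes "finite I" "orthonormal_on I u"
  shows "(norm v)\<^sup>2 = (norm (residual I u v))\<^sup>2 + (\<Sum>j\<in>I. (cmod (cinner v (u j)))\<^sup>2)"
proof -
  have "complex_of_real ((norm v)\<^sup>2) =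
      complex_of_real ((norm (residual I u v))\<^sup>2 + (\<Sum>j\<in>I. (cmod (cinner v (u j)))\<^sup>2))"
    unfolding cinner_self[symmetric] of_real_add of_real_sum complex_norm_square
    by (rule cinner_residual_split[OF assms])
  then show ?thesis by (simp only: of_real_eq_iff)
qed

lemma norm_residual_le:
  assumes "finite I" "orthonormal_on I u"
  shows "norm (residual I u v) \<le> norm v"
proof (rule power2_le_imp_le)
  show "(norm (residual I u v))\<^sup>2 \<le> (norm v)\<^sup>2"
    using norm_residual_split[OF assms, of v] by (simp add: sum_nonneg)
qed simp

lemma residual_span:
  assumes "finite I" "orthonormal_on I u" "v \<in> complex_vector.span (u ` I)"
  shows "residual I u v = 0"
  using assms(3)
proof (induction rule: complex_vector.span_induct_alt)
  case base
  show ?case by (simp add: residual_def)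
next
  case (step c x y)
  then obtain i where i: "i \<in> I" "x = u i" by auto
  have "(\<Sum>j\<in>I. cinner x (u j) *\<^sub>C u j) = (\<Sum>j\<in>I. if i = j then u j else 0)"
    using assms(2) i by (intro sum.cong) (auto simp: orthonormal_on_def)
  then have "residual I u x = 0"
    using i assms(1) by (simp add: residual_def)
  then show ?case using step by (simp add: residual_add residual_scaleC)
qed

section \<open>Spectral bounds\<close>

lemma operator_on_diff:
  assumes "operator_on D A" "v \<in> D" "w \<in> D"
  shows "A (v - w) = A v - A w"
proof -
  have "v - w \<in> D"
    using assms complex_vector.subspace_diff by (auto simp: operator_on_def)
  then have "A (v - w + w) = A (v - w) + A w"
    using assms unfolding operator_on_def by blast
  then show ?thesis by simp
qed

lemma operator_on_sum_scaleC:
  assumes "operator_on D A" "\<And>i. i \<in> I \<Longrightarrow> v i \<in> D"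
  shows "(\<Sum>i\<in>I. c i *\<^sub>C v i) \<in> D \<and> A (\<Sum>i\<in>I. c i *\<^sub>C v i) = (\<Sum>i\<in>I. c i *\<^sub>C A (v i))"
  using assms(2)
proof (induction I rule: infinite_finite_induct)
  case (insert i I)
  then have "c i *\<^sub>C v i \<in> D"
    using assms(1) complex_vector.subspace_scale by (auto simp: operator_on_def)
  with insert assms(1) show ?case
    by (simp add: operator_on_def complex_vector.subspace_add)
next
  case empty
  have "0 \<in> D" using assms(1) complex_vector.subspace_0 by (auto simp: operator_on_def)
  then show ?case using operator_on_diff[OF assms(1), of 0 0] by simp
next
  case (infinite I)
  have "0 \<in> D" using assms(1) complex_vector.subspace_0 by (auto simp: operator_on_def)
  then show ?case using operator_on_diff[OF assms(1), of 0 0] infinite by simp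
qed

lemma self_adjoint_on_imp_symmetric_on:
  assumes "self_adjoint_on D A"
  shows "symmetric_on D A"
  unfolding symmetric_on_def
proof (intro ballI)
  fix v w assume "v \<in> D" "w \<in> D"
  then have "(w, A w) \<in> adjoint_graph D A"
    using assms by (auto simp: self_adjoint_on_def operator_graph_def)
  with \<open>v \<in> D\<close> show "cinner (A v) w = cinner v (A w)"
    by (simp add: adjoint_graph_def)
qed

section \<open>A symmetric operator with an orthonormal eigenbasis\<close>

context
  fixes D :: "'a::complex_inner set" and A :: "'a \<Rightarrow> 'a"
    and ev :: "nat \<Rightarrow> real" and u :: "nat \<Rightarrow> 'a"
  assumes A_operator: "operator_on D A"
    and A_symmetric: "symmetric_on D A"
    and ev_mono: "mono_on {1..} ev"
    and u_basis: "orthonormal_basis u"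
    and u_eigen: "\<And>i. 1 \<le> i \<Longrightarrow> u i \<in> D \<and> A (u i) = complex_of_real (ev i) *\<^sub>C u i"
begin

lemma u_orthonormal: "I \<subseteq> {1..} \<Longrightarrow> orthonormal_on I u"
  using u_basis by (auto simp: orthonormal_basis_def orthonormal_on_def subset_iff)

lemma cinner_A_eigenvector:
  assumes "v \<in> D" "1 \<le> i"
  shows "cinner (A v) (u i) = complex_of_real (ev i) * cinner v (u i)"
  using assms A_symmetric u_eigen by (simp add: symmetric_on_def cinner_scaleC_right)

lemma residual_in_domain:
  assumes "v \<in> D" "I \<subseteq> {1..}"
  shows "residual I u v \<in> D"
proof -
  have "(\<Sum>j\<in>I. cinner v (u j) *\<^sub>C u j) \<in> D"
    using assms u_eigen by (intro operator_on_sum_scaleC[OF A_operator, THEN conjunct1]) auto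
  then show ?thesis
    using assms A_operator complex_vector.subspace_diff
    by (auto simp: residual_def operator_on_def)
qed

text \<open>\<open>A\<close> commutes with \<open>1 - P\<close>: the \<open>u j\<close> are
  eigenvectors, and symmetry with a real eigenvalue turns the coefficients of \<open>v\<close> into
  those of \<open>A v\<close>.\<close>

lemma A_residual:
  assumes "v \<in> D" "I \<subseteq> {1..}"
  shows "A (residual I u v) = residual I u (A v)"
proof -
  have u: "u j \<in> D" "A (u j) = complex_of_real (ev j) *\<^sub>C u j" if "j \<in> I" for j
    using that assms u_eigen by auto
  have S: "(\<Sum>j\<in>I. cinner v (u j) *\<^sub>C u j) \<in> D"
      "A (\<Sum>j\<in>I. cinner v (u j) *\<^sub>C u j) = (\<Sum>j\<in>I. cinner v (u j) *\<^sub>C A (u j))"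
    using operator_on_sum_scaleC[OF A_operator, of I u "\<lambda>j. cinner v (u j)"] u(1) by simp_all
  have "(\<Sum>j\<in>I. cinner v (u j) *\<^sub>C A (u j)) = (\<Sum>j\<in>I. cinner (A v) (u j) *\<^sub>C u j)"
    using assms by (intro sum.cong) (auto simp: u(2) cinner_A_eigenvector scaleC_scaleC mult.commute)
  with S show ?thesis
    by (simp add: residual_def operator_on_diff[OF A_operator assms(1)])
qed

lemma Re_cinner_A_split:
  assumes "v \<in> D" "I \<subseteq> {1..}" "finite I"
  shows "Re (cinner (A v) v) = Re (cinner (A (residual I u v)) (residual I u v)) +
    (\<Sum>j\<in>I. ev j * (cmod (cinner v (u j)))\<^sup>2)"
proof -
  have "(\<Sum>j\<in>I. cinner (A v) (u j) * cnj (cinner v (u j))) =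
      complex_of_real (\<Sum>j\<in>I. ev j * (cmod (cinner v (u j)))\<^sup>2)"
    unfolding of_real_sum of_real_mult complex_norm_square using assms
    by (intro sum.cong) (auto simp: cinner_A_eigenvector)
  with cinner_residual_split[OF assms(3) u_orthonormal[OF assms(2)], of "A v" v] show ?thesis
    by (simp add: A_residual[OF assms(1,2)])
qed

text \<open>The lower bound of the min-max principle. Coefficients of \<open>v\<close> below
  \<open>k + 1\<close> vanish and the others carry eigenvalues at least \<open>ev (k + 1)\<close>.
  Density gives approximation in norm only, with no control on \<open>A\<close> of the approximant,
  so the remainder is handled through residuals, which commute with \<open>A\<close>.\<close>

lemma Re_cinner_A_ge:
  assumes v: "v \<in> D" and orth: "\<And>j. j \<in> {1..k} \<Longrightarrow> cinner v (u j) = 0"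
  shows "ev (k + 1) * (norm v)\<^sup>2 \<le> Re (cinner (A v) v)"
proof (rule field_le_epsilon)
  fix e :: real assume "0 < e"
  define h where "h = A v - complex_of_real (ev (k + 1)) *\<^sub>C v"
  \<comment> \<open>Chosen so that \<open>norm h * d \<le> e\<close>; the added 1 covers
    \<open>h = 0\<close>.\<close>
  define d where "d = e / (norm h + 1)"
  have "0 < d" using \<open>0 < e\<close> by (simp add: d_def add_nonneg_pos)
  have "v \<in> closure (complex_vector.span (u ` {1..}))"
    using u_basis by (simp add: orthonormal_basis_def)
  then obtain w where w: "w \<in> complex_vector.span (u ` {1..})" "dist w v < d"
    using \<open>0 < d\<close> closure_approachable by blast
  then obtain S c where S: "finite S" "S \<subseteq> u ` {1..}" "w = (\<Sum>a\<in>S. c a *\<^sub>C a)"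
    unfolding complex_vector.span_explicit by blast
  then obtain I where I: "I \<subseteq> {1..}" "finite I" "S = u ` I"
    using finite_subset_image[OF S(1,2)] by blast
  have "w \<in> complex_vector.span (u ` I)"
    unfolding S(3) I(3)
    by (intro complex_vector.span_sum complex_vector.span_scale complex_vector.span_base)
  note orthonormal = \<open>finite I\<close> u_orthonormal[OF I(1)]
  have "residual I u w = 0"
    using \<open>w \<in> complex_vector.span (u ` I)\<close> by (rule residual_span[OF orthonormal])
  \<comment> \<open>The residual kills \<open>w\<close>, so it sees only the approximation error
    \<open>v - w\<close>.\<close>
  then have "norm (residual I u v) \<le> norm (v - w)"
    using norm_residual_le[OF orthonormal, of "v - w"] by (simp add: residual_diff)
  then have rv: "norm (residual I u v) \<le> d"
    using w(2) by (simp add: dist_norm norm_minus_commute)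
  have "(\<Sum>j\<in>I. ev (k + 1) * (cmod (cinner v (u j)))\<^sup>2) \<le> (\<Sum>j\<in>I. ev j * (cmod (cinner v (u j)))\<^sup>2)"
  proof (rule sum_mono)
    fix j assume "j \<in> I"
    with I have j: "1 \<le> j" by auto
    show "ev (k + 1) * (cmod (cinner v (u j)))\<^sup>2 \<le> ev j * (cmod (cinner v (u j)))\<^sup>2"
    proof (cases "j \<le> k")
      case True
      then show ?thesis using orth j by simp
    next
      case False
      then show ?thesis
        using mono_onD[OF ev_mono, of "k + 1" j] j by (intro mult_right_mono) auto
    qed
  qed
  then have "ev (k + 1) * ((norm v)\<^sup>2 - (norm (residual I u v))\<^sup>2) \<le>
      Re (cinner (A v) v) - Re (cinner (A (residual I u v)) (residual I u v))"
    using Re_cinner_A_split[OF v I(1,2)] norm_residual_split[OF orthonormal, of v]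
    by (simp add: sum_distrib_left)
  \<comment> \<open>The defect of the bound on the residual becomes a scalar product of a vector of
    norm at most \<open>norm h\<close> with one of norm at most \<open>d\<close>.\<close>
  moreover have "residual I u h = A (residual I u v) - complex_of_real (ev (k + 1)) *\<^sub>C residual I u v"
    by (simp add: h_def residual_diff residual_scaleC A_residual[OF v I(1)])
  then have "Re (cinner (residual I u h) (residual I u v)) =
      Re (cinner (A (residual I u v)) (residual I u v)) - ev (k + 1) * (norm (residual I u v))\<^sup>2"
    by (simp add: cinner_diff_left cinner_scaleC_left cinner_self)
  moreover have "\<bar>Re (cinner (residual I u h) (residual I u v))\<bar> \<le> norm h * d"
    using abs_Re_cinner_le[of "residual I u h" "residual I u v"]
      mult_mono[OF norm_residual_le[OF orthonormal, of h] rv] by simp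
  moreover have "norm h * d \<le> e"
  proof -
    have "norm h * d \<le> (norm h + 1) * d" using \<open>0 < d\<close> by simp
    also have "\<dots> = e" using norm_ge_zero[of h] by (simp add: d_def add_nonneg_eq_0_iff)
    finally show ?thesis .
  qed
  ultimately show "ev (k + 1) * (norm v)\<^sup>2 \<le> Re (cinner (A v) v) + e"
    by (simp add: algebra_simps)
qed

end

section \<open>Commutator terms as real expressions\<close>

text \<open>Moving \<open>T\<close> and then \<open>B\<close> to the other side gives minus the sum
  of a number and its conjugate. The domain conditions are what permits the two moves.\<close>

lemma cinner_commutator_skew_symmetric:
  assumes "skew_symmetric_on D T" "symmetric_on domB B"
    and "v \<in> D" "B v \<in> D" "v \<in> domB" "T v \<in> domB"
  shows "cinner (commutator T B v) v = complex_of_real (- 2 * Re (cinner (T v) (B v)))"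
proof -
  have "cinner (T (B v)) v = - cinner (B v) (T v)"
    using assms by (simp add: skew_symmetric_on_def)
  moreover have "cinner (B (T v)) v = cinner (T v) (B v)"
    using assms by (simp add: symmetric_on_def)
  moreover have "cinner (B v) (T v) = cnj (cinner (T v) (B v))"
    by (rule cinner_commute)
  ultimately show ?thesis
    by (simp add: commutator_def cinner_diff_left complex_eq_iff)
qed

text \<open>The eigenvalue equation reduces \<open>B (A v)\<close> to a multiple of
  \<open>B v\<close>, and symmetry of \<open>A\<close> makes the remaining form real.\<close>

lemma cinner_commutator_eigenvector:
  assumes "symmetric_on D A" "operator_on domB B"
    and "v \<in> domB" "B v \<in> D" "A v = complex_of_real l *\<^sub>C v"
  shows "cinner (commutator A B v) (B v) =
    complex_of_real (Re (cinner (A (B v)) (B v)) - l * (norm (B v))\<^sup>2)"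
proof -
  have "cinner (A (B v)) (B v) = cnj (cinner (A (B v)) (B v))"
    using assms by (metis cinner_commute symmetric_on_def)
  then have "Im (cinner (A (B v)) (B v)) = 0"
    by (simp add: complex_eq_iff)
  moreover have "B (A v) = complex_of_real l *\<^sub>C B v"
    using assms by (simp add: operator_on_def)
  ultimately show ?thesis
    by (simp add: commutator_def cinner_diff_left cinner_scaleC_left cinner_self complex_eq_iff)
qed

section \<open>The main inequality\<close>

text \<open>The defining condition multiplied by \<open>(x - y)\<^sup>2\<close>, which gives the
  shape \<open>b\<^sup>2 \<le> a * c\<close> required by \<open>quadratic_form_nonneg\<close> and
  also covers \<open>x = y\<close>.\<close>

lemma Im_class_square_diff_le:
  assumes "(f, g) \<in> Im_class l" "x \<in> {0<..<l}" "y \<in> {0<..<l}"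
  shows "(f x - f y)\<^sup>2 \<le> ((g x - g y) * (y - x)) *
    ((f x)\<^sup>2 / (g x * (l - x)) + (f y)\<^sup>2 / (g y * (l - y)))"
proof (cases "x = y")
  case False
  define w where "w = (f x)\<^sup>2 / (g x * (l - x)) + (f y)\<^sup>2 / (g y * (l - y))"
  have "((f x - f y) / (x - y))\<^sup>2 + w * ((g x - g y) / (x - y)) \<le> 0"
    using assms False by (auto simp: Im_class_def w_def)
  then have "(x - y)\<^sup>2 * (((f x - f y) / (x - y))\<^sup>2 + w * ((g x - g y) / (x - y))) \<le> 0"
    by (simp add: mult_nonneg_nonpos)
  also have "(x - y)\<^sup>2 * (((f x - f y) / (x - y))\<^sup>2 + w * ((g x - g y) / (x - y))) =
      (f x - f y)\<^sup>2 + w * ((g x - g y) * (x - y))"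
    using False by (simp add: power_divide distrib_left) (simp add: power2_eq_square)
  finally show ?thesis
    unfolding w_def[symmetric] by (simp add: algebra_simps)
qed simp

text \<open>The estimate for a single pair \<open>T\<close>, \<open>B\<close>, with the commutators
  already in real form. It is stated for every \<open>s\<close>, so that summation over the pairs
  can take place before the discriminant is formed.\<close>

lemma commutator_quadratic_nonneg:
  fixes D :: "'a::complex_inner set"
  assumes A: "operator_on D A" "symmetric_on D A"
    and ev_mono: "mono_on {1..} ev"
    and u_basis: "orthonormal_basis u"
    and u_eigen: "\<And>i. 1 \<le> i \<Longrightarrow> u i \<in> D \<and> A (u i) = complex_of_real (ev i) *\<^sub>C u i"
    and ev_pos: "0 < ev 1" and gap: "ev k < ev (k + 1)"
    and fg: "(f, g) \<in> Im_class (ev (k + 1))"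
    and T: "skew_symmetric_on D T"
    and B: "symmetric_on domB B" "D \<subseteq> domB" "B ` D \<subseteq> D"
  shows "0 \<le> s\<^sup>2 * (\<Sum>i=1..k. g (ev i) * (Re (cinner (A (B (u i))) (B (u i))) - ev i * (norm (B (u i)))\<^sup>2)) +
    s * (\<Sum>i=1..k. f (ev i) * (- 2 * Re (cinner (T (u i)) (B (u i))))) +
    (\<Sum>i=1..k. (f (ev i))\<^sup>2 / (g (ev i) * (ev (k + 1) - ev i)) * (norm (T (u i)))\<^sup>2)"
proof -
  define I where "I = {1..k}"
  have I: "finite I" "I \<subseteq> {1..}" by (auto simp: I_def)
  have ON: "orthonormal_on I u"
    using u_basis by (auto simp: I_def orthonormal_basis_def orthonormal_on_def)
  have uD: "u i \<in> D" "B (u i) \<in> D" if "i \<in> I" for i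
    using that u_eigen B by (auto simp: I_def)
  define L where "L = ev (k + 1)"
  have ev: "0 < ev i" "ev i < L" if "i \<in> I" for i
    using mono_onD[OF ev_mono, of 1 i] mono_onD[OF ev_mono, of i k] that ev_pos gap
    by (auto simp: I_def L_def)
  define w where "w i = (f (ev i))\<^sup>2 / (g (ev i) * (L - ev i))" for i
  have pos: "0 < f (ev i)" "0 < g (ev i)" if "i \<in> I" for i
    using fg ev[OF that] by (auto simp: Im_class_def L_def)
  have w_pos: "0 < w i" if "i \<in> I" for i
    using pos[OF that] ev[OF that] by (simp add: w_def)
  define \<phi> where "\<phi> i = residual I u (B (u i))" for i
  define \<psi> where "\<psi> i = residual I u (T (u i))" for i
  define a where "a i j = cinner (B (u i)) (u j)" for i j
  define t where "t i j = cinner (T (u i)) (u j)" for i j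
  define r where "r i j = Re (t i j * cnj (a i j))" for i j
  \<comment> \<open>The entries of \<open>B\<close> are Hermitian and those of \<open>T\<close>
    skew-Hermitian. Hence the moduli are symmetric in \<open>i\<close>, \<open>j\<close> and
    \<open>r\<close> is antisymmetric, which produces differences of \<open>f\<close> and of
    \<open>g\<close> below.\<close>
  have a_sym: "a j i = cnj (a i j)" if "i \<in> I" "j \<in> I" for i j
    using uD[OF that(1)] uD[OF that(2)] B cinner_commute[of "B (u i)" "u j"]
    by (auto simp: a_def symmetric_on_def)
  have t_skew: "t j i = - cnj (t i j)" if "i \<in> I" "j \<in> I" for i j
    using uD[OF that(1)] uD[OF that(2)] T cinner_commute[of "u j" "T (u i)"]
    by (simp add: t_def skew_symmetric_on_def)
  \<comment> \<open>This is an inequality because \<open>A\<close> is bounded below by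
    \<open>L\<close> on \<open>\<phi> i\<close>; the expansions \<open>X\<close> and
    \<open>W\<close> are exact.\<close>
  have G: "(L - ev i) * (norm (\<phi> i))\<^sup>2 + (\<Sum>j\<in>I. (ev j - ev i) * (cmod (a i j))\<^sup>2) \<le>
      Re (cinner (A (B (u i))) (B (u i))) - ev i * (norm (B (u i)))\<^sup>2" if "i \<in> I" for i
  proof -
    have "L * (norm (\<phi> i))\<^sup>2 \<le> Re (cinner (A (\<phi> i)) (\<phi> i))"
      unfolding L_def
    proof (rule Re_cinner_A_ge[OF A ev_mono u_basis u_eigen])
      show "\<phi> i \<in> D"
        unfolding \<phi>_def
        by (rule residual_in_domain[OF A ev_mono u_basis u_eigen uD(2)[OF that] I(2)])
      show "cinner (\<phi> i) (u j) = 0" if "j \<in> {1..k}" for j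
        using that cinner_residual_left[OF I(1) ON] by (simp add: \<phi>_def I_def)
    qed
    moreover have "Re (cinner (A (B (u i))) (B (u i))) =
        Re (cinner (A (\<phi> i)) (\<phi> i)) + (\<Sum>j\<in>I. ev j * (cmod (a i j))\<^sup>2)"
      unfolding \<phi>_def a_def
      by (rule Re_cinner_A_split[OF A ev_mono u_basis u_eigen uD(2)[OF that] I(2,1)])
    ultimately show ?thesis
      using norm_residual_split[OF I(1) ON, of "B (u i)"]
      by (simp add: \<phi>_def[symmetric] a_def[symmetric] algebra_simps sum_subtractf sum_distrib_left)
  qed
  have X: "Re (cinner (T (u i)) (B (u i))) = Re (cinner (\<psi> i) (\<phi> i)) + (\<Sum>j\<in>I. r i j)" for i
    using cinner_residual_split[OF I(1) ON, of "T (u i)" "B (u i)"]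
    by (simp add: \<phi>_def \<psi>_def r_def a_def t_def)
  have W: "(norm (T (u i)))\<^sup>2 = (norm (\<psi> i))\<^sup>2 + (\<Sum>j\<in>I. (cmod (t i j))\<^sup>2)" for i
    using norm_residual_split[OF I(1) ON, of "T (u i)"] by (simp add: \<psi>_def t_def)
  define q where "q i j = s\<^sup>2 * (g (ev i) * ((ev j - ev i) * (cmod (a i j))\<^sup>2)) +
    s * (f (ev i) * (- 2 * r i j)) + w i * (cmod (t i j))\<^sup>2" for i j
  have "0 \<le> (\<Sum>i\<in>I. \<Sum>j\<in>I. q i j)"
  proof (rule double_sum_nonneg_symmetrized)
    fix i j assume ij: "i \<in> I" "j \<in> I"
    have le: "(f (ev i) - f (ev j))\<^sup>2 \<le> ((g (ev i) - g (ev j)) * (ev j - ev i)) * (w i + w j)"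
      unfolding w_def L_def
      using Im_class_square_diff_le[OF fg] ev[OF ij(1)] ev[OF ij(2)] by (simp add: L_def)
    have "0 \<le> ((g (ev i) - g (ev j)) * (ev j - ev i)) * (w i + w j)"
      using le zero_le_power2 order_trans by blast
    \<comment> \<open>Since \<open>w i + w j\<close> is positive, the class condition forces
      \<open>g\<close> to be nonincreasing along the eigenvalues.\<close>
    then have "0 \<le> (g (ev i) - g (ev j)) * (ev j - ev i)"
      using w_pos[OF ij(1)] w_pos[OF ij(2)] by (simp only: zero_le_mult_iff) linarith
    moreover have "\<bar>r i j\<bar> \<le> cmod (a i j) * cmod (t i j)"
      unfolding r_def using abs_Re_le_cmod[of "t i j * cnj (a i j)"]
      by (simp add: norm_mult mult.commute)
    ultimately have "0 \<le> s\<^sup>2 * (((g (ev i) - g (ev j)) * (ev j - ev i)) * (cmod (a i j))\<^sup>2) +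
        s * (- 2 * (f (ev i) - f (ev j)) * r i j) + (w i + w j) * (cmod (t i j))\<^sup>2"
      using le w_pos[OF ij(1)] w_pos[OF ij(2)] by (intro quadratic_form_nonneg) auto
    also have "\<dots> = q i j + q j i"
    proof -
      have "r j i = - r i j"
        by (simp add: r_def a_sym[OF ij] t_skew[OF ij])
      then show ?thesis
        by (simp add: q_def a_sym[OF ij] t_skew[OF ij] algebra_simps)
    qed
    finally show "0 \<le> q i j + q j i" .
  qed
  \<comment> \<open>Here \<open>b\<^sup>2 = a * c\<close> holds with equality: the weight
    \<open>w i\<close> is exactly \<open>(f (ev i))\<^sup>2\<close> divided by the coefficient
    \<open>g (ev i) * (L - ev i)\<close>.\<close>
  moreover have "0 \<le> s\<^sup>2 * (g (ev i) * (L - ev i) * (norm (\<phi> i))\<^sup>2) +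
      s * (- 2 * f (ev i) * Re (cinner (\<psi> i) (\<phi> i))) + w i * (norm (\<psi> i))\<^sup>2" if "i \<in> I" for i
    using pos[OF that] ev[OF that] w_pos[OF that] abs_Re_cinner_le[of "\<psi> i" "\<phi> i"]
    by (intro quadratic_form_nonneg) (auto simp: w_def mult.commute)
  then have "0 \<le> (\<Sum>i\<in>I. s\<^sup>2 * (g (ev i) * (L - ev i) * (norm (\<phi> i))\<^sup>2) +
      s * (- 2 * f (ev i) * Re (cinner (\<psi> i) (\<phi> i))) + w i * (norm (\<psi> i))\<^sup>2)"
    by (rule sum_nonneg)
  ultimately have "0 \<le> (\<Sum>i\<in>I. s\<^sup>2 * (g (ev i) * (L - ev i) * (norm (\<phi> i))\<^sup>2) +
      s * (- 2 * f (ev i) * Re (cinner (\<psi> i) (\<phi> i))) + w i * (norm (\<psi> i))\<^sup>2 + (\<Sum>j\<in>I. q i j))"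
    by (simp add: sum.distrib)
  also have "\<dots> = (\<Sum>i\<in>I. s\<^sup>2 * (g (ev i) * ((L - ev i) * (norm (\<phi> i))\<^sup>2 +
        (\<Sum>j\<in>I. (ev j - ev i) * (cmod (a i j))\<^sup>2))) +
      s * (f (ev i) * (- 2 * Re (cinner (T (u i)) (B (u i))))) + w i * (norm (T (u i)))\<^sup>2)"
    unfolding X W q_def
    by (intro sum.cong refl) (simp add: sum.distrib sum_distrib_left sum_negf sum_subtractf algebra_simps)
  \<comment> \<open>Positivity of \<open>g\<close> lets the bound \<open>G\<close> enter with the
    factor \<open>s\<^sup>2 * g (ev i)\<close>.\<close>
  also have "\<dots> \<le> (\<Sum>i\<in>I. s\<^sup>2 * (g (ev i) *
        (Re (cinner (A (B (u i))) (B (u i))) - ev i * (norm (B (u i)))\<^sup>2)) +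
      s * (f (ev i) * (- 2 * Re (cinner (T (u i)) (B (u i))))) + w i * (norm (T (u i)))\<^sup>2)"
    using G pos by (intro sum_mono add_right_mono mult_left_mono) (auto intro: less_imp_le)
  finally show ?thesis
    by (simp only: sum.distrib sum_distrib_left I_def w_def L_def)
qed

theorem theorem2p1:
  fixes A :: "'h::chilbert_space \<Rightarrow> 'h" and D :: "'h set"
    and ev :: "nat \<Rightarrow> real" and u :: "nat \<Rightarrow> 'h"
    and T B :: "nat \<Rightarrow> 'h \<Rightarrow> 'h" and domB :: "nat \<Rightarrow> 'h set"
    and n k :: nat and f g :: "real \<Rightarrow> real"
  assumes A_self_adjoint: "self_adjoint_on D A"
    and A_semibounded: "semibounded_below_on D A"
    and A_discrete: "discrete_spectrum D A"
    and eigenvalues: "eigenvalue_sequence D A ev"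
    and ev_pos: "0 < ev 1"
    and n_ge_1: "1 \<le> n"
    and T_operator: "\<And>p. p \<in> {1..n} \<Longrightarrow> operator_on D (T p)"
    and T_skew: "\<And>p. p \<in> {1..n} \<Longrightarrow> skew_symmetric_on D (T p)"
    and B_operator: "\<And>p. p \<in> {1..n} \<Longrightarrow> operator_on (domB p) (B p)"
    and B_symmetric: "\<And>p. p \<in> {1..n} \<Longrightarrow> symmetric_on (domB p) (B p)"
    and B_domain: "\<And>p. p \<in> {1..n} \<Longrightarrow> D \<subseteq> domB p \<and> T p ` D \<subseteq> domB p"
    and B_invariant: "\<And>p. p \<in> {1..n} \<Longrightarrow> B p ` D \<subseteq> D"
    and u_basis: "orthonormal_basis u"
    and u_eigen: "\<And>i. 1 \<le> i \<Longrightarrow> u i \<in> D \<and> A (u i) = complex_of_real (ev i) *\<^sub>C u i"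
    and k_ge_1: "1 \<le> k"
    and gap: "ev k < ev (k + 1)"
    and fg: "(f, g) \<in> Im_class (ev (k + 1))"
  shows "(\<Sum>i=1..k. \<Sum>p=1..n.
            complex_of_real (f (ev i)) * cinner (commutator (T p) (B p) (u i)) (u i))\<^sup>2
         \<le> 4 * (\<Sum>i=1..k. \<Sum>p=1..n.
                  complex_of_real (g (ev i)) * cinner (commutator A (B p) (u i)) (B p (u i)))
             * complex_of_real (\<Sum>i=1..k. \<Sum>p=1..n.
                  (f (ev i))\<^sup>2 / (g (ev i) * (ev (k + 1) - ev i)) * (norm (T p (u i)))\<^sup>2)"
proof -
  have A: "operator_on D A" "symmetric_on D A"
    using A_self_adjoint self_adjoint_on_imp_symmetric_on by (auto simp: self_adjoint_on_def)
  have ev_mono: "mono_on {1..} ev"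
    using eigenvalues by (simp add: eigenvalue_sequence_def)
  define X where "X = (\<Sum>i=1..k. \<Sum>p=1..n. f (ev i) * (- 2 * Re (cinner (T p (u i)) (B p (u i)))))"
  define G where "G = (\<Sum>i=1..k. \<Sum>p=1..n. g (ev i) *
    (Re (cinner (A (B p (u i))) (B p (u i))) - ev i * (norm (B p (u i)))\<^sup>2))"
  define W where "W = (\<Sum>i=1..k. \<Sum>p=1..n.
    (f (ev i))\<^sup>2 / (g (ev i) * (ev (k + 1) - ev i)) * (norm (T p (u i)))\<^sup>2)"
  have "0 \<le> s\<^sup>2 * G + s * X + W" for s
  proof -
    \<comment> \<open>Exchanging the sums puts \<open>p\<close> outside, so that the estimate for
      one pair applies for each \<open>p\<close> with the same \<open>s\<close>.\<close>
    have "s\<^sup>2 * G + s * X + W = (\<Sum>p=1..n.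
        s\<^sup>2 * (\<Sum>i=1..k. g (ev i) *
          (Re (cinner (A (B p (u i))) (B p (u i))) - ev i * (norm (B p (u i)))\<^sup>2)) +
        s * (\<Sum>i=1..k. f (ev i) * (- 2 * Re (cinner (T p (u i)) (B p (u i))))) +
        (\<Sum>i=1..k. (f (ev i))\<^sup>2 / (g (ev i) * (ev (k + 1) - ev i)) * (norm (T p (u i)))\<^sup>2))"
      by (simp only: G_def X_def W_def sum.distrib sum_distrib_left sum.swap[of _ "{1..k}" "{1..n}"])
    also have "0 \<le> \<dots>"
      using B_domain
      by (intro sum_nonneg commutator_quadratic_nonneg[OF A ev_mono u_basis u_eigen ev_pos gap fg
            T_skew B_symmetric _ B_invariant]) auto
    finally show ?thesis .
  qed
  then have "X\<^sup>2 \<le> 4 * G * W" by (rule discriminant_le_zero)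
  \<comment> \<open>The order on \<open>complex\<close> also demands equal imaginary parts; both
    sides are images of reals, and the two commutator sums are identified with \<open>X\<close> and
    \<open>G\<close> next.\<close>
  then have "complex_of_real (X\<^sup>2) \<le> complex_of_real (4 * G * W)"
    by (simp only: less_eq_complex_def Re_complex_of_real Im_complex_of_real)
  moreover have "(\<Sum>i=1..k. \<Sum>p=1..n.
      complex_of_real (f (ev i)) * cinner (commutator (T p) (B p) (u i)) (u i)) = complex_of_real X"
    unfolding X_def of_real_sum of_real_mult
  proof (intro sum.cong refl)
    fix i p assume i: "i \<in> {1..k}" and p: "p \<in> {1..n}"
    have u: "u i \<in> D" using u_eigen i by simp
    show "complex_of_real (f (ev i)) * cinner (commutator (T p) (B p) (u i)) (u i) =
        complex_of_real (f (ev i)) *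
        (complex_of_real (- 2) * complex_of_real (Re (cinner (T p (u i)) (B p (u i)))))"
      using u B_domain[OF p] B_invariant[OF p]
        cinner_commutator_skew_symmetric[OF T_skew[OF p] B_symmetric[OF p]] by force
  qed
  moreover have "(\<Sum>i=1..k. \<Sum>p=1..n.
      complex_of_real (g (ev i)) * cinner (commutator A (B p) (u i)) (B p (u i))) = complex_of_real G"
    unfolding G_def of_real_sum
  proof (intro sum.cong refl)
    fix i p assume i: "i \<in> {1..k}" and p: "p \<in> {1..n}"
    have u: "u i \<in> D" "A (u i) = complex_of_real (ev i) *\<^sub>C u i" using u_eigen i by simp_all
    have "u i \<in> domB p" "B p (u i) \<in> D"
      using u B_domain[OF p] B_invariant[OF p] by auto
    from cinner_commutator_eigenvector[OF A(2) B_operator[OF p] this u(2)]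
    show "complex_of_real (g (ev i)) * cinner (commutator A (B p) (u i)) (B p (u i)) =
        complex_of_real (g (ev i) *
          (Re (cinner (A (B p (u i))) (B p (u i))) - ev i * (norm (B p (u i)))\<^sup>2))"
      by simp
  qed
  ultimately show ?thesis
    by (simp only: W_def of_real_mult of_real_power of_real_numeral)
qed

end
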